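(* Let $\mathbb{A}$ be the Alexandroff-Urysohn double arrow space and let ${}^{\omega}2$ be the Cantor set. Then the product space $\mathbb{A}\times{}^{\omega}2$ is not countable dense homogeneous.
   Context: The Alexandroff-Urysohn double arrow space: let $\mathbb{A}_0=(0,1]\times\{0\}$, $\mathbb{A}_1=[0,1)\times\{1\}$ and $\mathbb{A}=\mathbb{A}_0\cup\mathbb{A}_1$, with the strict lexicographic order $\langle x,t\rangle<\langle y,s\rangle$ iff $x<y$, or $x=y$ and $t<s$; $\mathbb{A}$ carries the order topology. ${}^{\omega}2$ is the Cantor set $\{0,1\}^{\omega}$ with the product topology of discrete two-point spaces. A separable Hausdorff space $X$ is countable dense homogeneous (CDH) if for any two countable dense subsets $D,E$ of $X$ there is a homeomorphism $h:X\to X$ with $h[D]=E$. *)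

theory Defs
  imports "HOL-Analysis.Analysis"
begin

typedef double_arrow =
  "{0<..1::real} \<times> {0::nat} \<union> {0..<1::real} \<times> {1::nat}"
  by (rule exI[of _ "(0, 1)"]) simp

setup_lifting type_definition_double_arrow

instantiation double_arrow :: linorder
begin

lift_definition less_double_arrow :: "double_arrow \<Rightarrow> double_arrow \<Rightarrow> bool"
  is "\<lambda>(x, t) (y, s). x < y \<or> x = y \<and> t < s" .

definition less_eq_double_arrow :: "double_arrow \<Rightarrow> double_arrow \<Rightarrow> bool"
  where "less_eq_double_arrow a b \<longleftrightarrow> a < b \<or> a = b"

instance
proof
  fix a b c :: double_arrow
  show "(a < b) = (a \<le> b \<and> \<not> b \<le> a)"
    unfolding less_eq_double_arrow_def by transfer auto
  show "a \<le> a"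
    unfolding less_eq_double_arrow_def by simp
  show "a \<le> b \<Longrightarrow> b \<le> c \<Longrightarrow> a \<le> c"
    unfolding less_eq_double_arrow_def by transfer auto
  show "a \<le> b \<Longrightarrow> b \<le> a \<Longrightarrow> a = b"
    unfolding less_eq_double_arrow_def by transfer auto
  show "a \<le> b \<or> b \<le> a"
    unfolding less_eq_double_arrow_def by transfer force
qed

end

instantiation double_arrow :: linorder_topology
begin

definition open_double_arrow :: "double_arrow set \<Rightarrow> bool"
  where "open_double_arrow =
    generate_topology (range (\<lambda>a. {..<a}) \<union> range (\<lambda>a. {a<..}))"

instance
  by standard (rule open_double_arrow_def)

end

abbreviation double_arrow_space :: "double_arrow topology"
  where "double_arrow_space \<equiv> euclidean"

abbreviation cantor_space :: "(nat \<Rightarrow> bool) topology"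
  where "cantor_space \<equiv> product_topology (\<lambda>_. discrete_topology UNIV) UNIV"

definition countable_dense_homogeneous :: "'a topology \<Rightarrow> bool"
  where "countable_dense_homogeneous X \<longleftrightarrow>
    separable_space X \<and> Hausdorff_space X \<and>
    (\<forall>D E. countable D \<and> D \<subseteq> topspace X \<and> X closure_of D = topspace X \<and>
           countable E \<and> E \<subseteq> topspace X \<and> X closure_of E = topspace X
       \<longrightarrow> (\<exists>h. homeomorphic_map X X h \<and> h ` D = E))"

text \<open>The space of interest is separable and Hausdorff, so those two conjuncts of
  \<^const>\<open>countable_dense_homogeneous\<close> hold for it and only homogeneity can fail.\<close>

lemma separable_double_arrow_space: "separable_space double_arrow_space"
proof -
  define D where "D = {a. fst (Rep_double_arrow a) \<in> \<rat>}"
  have "D \<subseteq> Abs_double_arrow ` (\<rat> \<times> UNIV)"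
  proof
    fix a assume "a \<in> D"
    then have "Rep_double_arrow a \<in> \<rat> \<times> UNIV"
      by (simp add: D_def mem_Times_iff)
    then show "a \<in> Abs_double_arrow ` (\<rat> \<times> UNIV)"
      by (metis Rep_double_arrow_inverse image_eqI)
  qed
  moreover have "countable (Abs_double_arrow ` (\<rat> \<times> (UNIV :: nat set)))"
    by (simp add: countable_rat)
  ultimately have "countable D"
    by (rule countable_subset)
  moreover have "double_arrow_space closure_of D = topspace double_arrow_space"
    unfolding dense_intersects_open
  proof (intro allI impI)
    fix U :: "double_arrow set"
    assume "openin euclidean U \<and> U \<noteq> {}"
    then obtain a where U: "open U" "a \<in> U"
      by auto
    obtain x t where a: "Rep_double_arrow a = (x, t)"
      by (cases "Rep_double_arrow a")
    have mem: "0 < x \<and> x \<le> 1 \<and> t = 0 \<or> 0 \<le> x \<and> x < 1 \<and> t = 1"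
      using Rep_double_arrow[of a] a by auto
    have rep: "Rep_double_arrow (Abs_double_arrow (q, 0)) = (q, 0)" if "0 < q" "q \<le> 1" for q
      using that by (subst Abs_double_arrow_inverse) auto
    have rep1: "Rep_double_arrow (Abs_double_arrow (q, 1)) = (q, 1)" if "0 \<le> q" "q < 1" for q
      using that by (subst Abs_double_arrow_inverse) auto
    show "D \<inter> U \<noteq> {}"
    proof (cases "t = 0")
      case True
      have "Abs_double_arrow (0, 1) < a"
        using mem True a rep1[of 0] by (simp add: less_double_arrow.rep_eq)
      then obtain b where b: "b < a" "{b<..a} \<subseteq> U"
        using open_left[OF U] by blast
      obtain y s where y: "Rep_double_arrow b = (y, s)"
        by (cases "Rep_double_arrow b")
      have "0 \<le> y" "y < x"
        using Rep_double_arrow[of b] b(1) a y True by (auto simp: less_double_arrow.rep_eq)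
      obtain q where q: "q \<in> \<rat>" "y < q" "q < x"
        using Rats_dense_in_real[OF \<open>y < x\<close>] by blast
      have "Rep_double_arrow (Abs_double_arrow (q, 0)) = (q, 0)"
        using q \<open>0 \<le> y\<close> mem by (intro rep) auto
      then have "Abs_double_arrow (q, 0) \<in> D \<inter> {b<..a}"
        using q a y by (auto simp: D_def less_eq_double_arrow_def less_double_arrow.rep_eq)
      then show ?thesis
        using b(2) by blast
    next
      case False
      have "a < Abs_double_arrow (1, 0)"
        using mem False a rep[of 1] by (simp add: less_double_arrow.rep_eq)
      then obtain b where b: "a < b" "{a..<b} \<subseteq> U"
        using open_right[OF U] by blast
      obtain y s where y: "Rep_double_arrow b = (y, s)"
        by (cases "Rep_double_arrow b")
      have "y \<le> 1" "x < y"
        using Rep_double_arrow[of b] b(1) a y False mem by (auto simp: less_double_arrow.rep_eq)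
      obtain q where q: "q \<in> \<rat>" "x < q" "q < y"
        using Rats_dense_in_real[OF \<open>x < y\<close>] by blast
      have "Rep_double_arrow (Abs_double_arrow (q, 0)) = (q, 0)"
        using q \<open>y \<le> 1\<close> mem by (intro rep) auto
      then have "Abs_double_arrow (q, 0) \<in> D \<inter> {a..<b}"
        using q a y by (auto simp: D_def less_eq_double_arrow_def less_double_arrow.rep_eq)
      then show ?thesis
        using b(2) by blast
    qed
  qed
  ultimately show ?thesis
    unfolding separable_space_def by auto
qed

lemma cantor_space_eq_euclidean: "cantor_space = euclidean"
proof -
  have "discrete_topology (UNIV :: bool set) = euclidean"
    unfolding topology_eq by (auto simp: open_discrete)
  then show ?thesis
    by (simp only: euclidean_product_topology)
qed

instance bool :: second_countable_topology
proof
  show "\<exists>B :: bool set set. countable B \<and> open = generate_topology B"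
    by (intro exI[of _ "range lessThan \<union> range greaterThan"]) (auto simp: open_bool_def)
qed

lemma separable_cantor_space: "separable_space cantor_space"
proof -
  obtain C :: "(nat \<Rightarrow> bool) set"
    where C: "countable C" "\<And>U. open U \<Longrightarrow> U \<noteq> {} \<Longrightarrow> \<exists>d\<in>C. d \<in> U"
    using countable_dense_setE by blast
  then have "euclidean closure_of C = topspace euclidean"
    unfolding dense_intersects_open by auto
  then show ?thesis
    unfolding cantor_space_eq_euclidean separable_space_def using C(1)
    by (intro exI[of _ C]) simp
qed

lemma separable_double_arrow_times_cantor:
  "separable_space (prod_topology double_arrow_space cantor_space)"
proof -
  obtain C D where
    C: "countable C" "C \<subseteq> topspace double_arrow_space"
       "double_arrow_space closure_of C = topspace double_arrow_space" and
    D: "countable D" "D \<subseteq> topspace cantor_space"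
       "cantor_space closure_of D = topspace cantor_space"
    using separable_double_arrow_space separable_cantor_space
    unfolding separable_space_def by metis
  show ?thesis
    unfolding separable_space_def
    using C D by (intro exI[of _ "C \<times> D"]) (auto simp: closure_of_Times)
qed

lemma Hausdorff_double_arrow_times_cantor:
  "Hausdorff_space (prod_topology double_arrow_space cantor_space)"
proof -
  have "Hausdorff_space double_arrow_space"
    unfolding Hausdorff_space_def disjnt_def using hausdorff by auto
  then show ?thesis
    by (simp add: Hausdorff_space_prod_topology Hausdorff_space_product_topology)
qed

end

theory Submission
  imports Defs
begin

text \<open>Every compact metrizable subspace of the double arrow space is countable, so by the Baire
  category theorem a homeomorphism of the product maps some nonempty clopen piece of a fibre
  \<open>{a} \<times> \<^sup>\<omega>2\<close> into another fibre. A dense set of product form meets that piece in more than one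
  point, so it cannot be carried onto a dense set meeting every fibre at most once.\<close>

section \<open>Clopen rays and countable images in the double arrow space\<close>

lemma Rep_double_arrow_Abs_0: "0 < x \<Longrightarrow> x \<le> 1 \<Longrightarrow> Rep_double_arrow (Abs_double_arrow (x, 0)) = (x, 0)"
  by (subst Abs_double_arrow_inverse) auto

lemma Rep_double_arrow_Abs_1: "0 \<le> x \<Longrightarrow> x < 1 \<Longrightarrow> Rep_double_arrow (Abs_double_arrow (x, 1)) = (x, 1)"
  by (subst Abs_double_arrow_inverse) auto

lemma Rep_double_arrow_cases:
  obtains x where "Rep_double_arrow a = (x, 0)" "0 < x" "x \<le> 1"
  | x where "Rep_double_arrow a = (x, 1)" "0 \<le> x" "x < 1"
  using Rep_double_arrow[of a] by auto

text \<open>Doubling creates jumps: for 0 < x < 1 the point (x, 1) immediately succeeds (x, 0), so a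
  closed ray ending at the jump is also an open ray. For the greatest point (1, 0) and the least
  point (0, 1) the ray is the whole space.\<close>

lemma double_arrow_clopen_ray: "open {..a} \<or> open {a..}" for a :: double_arrow
proof (cases a rule: Rep_double_arrow_cases)
  case (1 x)
  have "open {..a}"
  proof (cases "x < 1")
    case True
    have "{..a} = {..<Abs_double_arrow (x, 1)}"
    proof (intro set_eqI)
      fix b
      show "b \<in> {..a} \<longleftrightarrow> b \<in> {..<Abs_double_arrow (x, 1)}"
        using 1 True Rep_double_arrow_Abs_1[of x]
        by (cases b rule: Rep_double_arrow_cases)
           (auto simp: less_eq_double_arrow_def less_double_arrow.rep_eq Rep_double_arrow_inject[symmetric])
    qed
    then show ?thesis by simp
  next
    case False
    have "{..a} = UNIV"
    proof (intro set_eqI)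
      fix b
      show "b \<in> {..a} \<longleftrightarrow> b \<in> UNIV"
        using 1 False
        by (cases b rule: Rep_double_arrow_cases)
           (auto simp: less_eq_double_arrow_def less_double_arrow.rep_eq Rep_double_arrow_inject[symmetric])
    qed
    then show ?thesis by simp
  qed
  then show ?thesis ..
next
  case (2 x)
  have "open {a..}"
  proof (cases "x > 0")
    case True
    have "{a..} = {Abs_double_arrow (x, 0)<..}"
    proof (intro set_eqI)
      fix b
      show "b \<in> {a..} \<longleftrightarrow> b \<in> {Abs_double_arrow (x, 0)<..}"
        using 2 True Rep_double_arrow_Abs_0[of x]
        by (cases b rule: Rep_double_arrow_cases)
           (auto simp: less_eq_double_arrow_def less_double_arrow.rep_eq Rep_double_arrow_inject[symmetric])
    qed
    then show ?thesis by simp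
  next
    case False
    have "{a..} = UNIV"
    proof (intro set_eqI)
      fix b
      show "b \<in> {a..} \<longleftrightarrow> b \<in> UNIV"
        using 2 False
        by (cases b rule: Rep_double_arrow_cases)
           (auto simp: less_eq_double_arrow_def less_double_arrow.rep_eq Rep_double_arrow_inject[symmetric])
    qed
    then show ?thesis by simp
  qed
  then show ?thesis ..
qed

text \<open>A value \<open>g c\<close> whose upper or lower ray is open is the least or the greatest element of the image
  of a basic open set, and there are only countably many of these.\<close>

lemma countable_range_into_double_arrow:
  fixes g :: "'a::second_countable_topology \<Rightarrow> double_arrow"
  assumes g: "continuous_on UNIV g"
  shows "countable (range g)"
proof -
  obtain B :: "'a set set" where B: "countable B" "topological_basis B"
    using ex_countable_basis by blast
  \<comment> \<open>Where the image has no least or greatest element these values are arbitrary.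
    This is harmless, as only an inclusion of \<open>range g\<close> is claimed.\<close>
  define m where "m = (\<lambda>b. LEAST y. y \<in> g ` b)"
  define M where "M = (\<lambda>b. GREATEST y. y \<in> g ` b)"
  have "range g \<subseteq> m ` B \<union> M ` B"
  proof clarify
    fix c assume c: "g c \<notin> M ` B"
    have *: "\<exists>b\<in>B. c \<in> b \<and> g ` b \<subseteq> S" if "open S" "g c \<in> S" for S
    proof -
      have "open (g -` S)"
        using g that(1) by (simp add: open_vimage)
      then show ?thesis
        using that(2) B(2) by (metis image_subset_iff_subset_vimage topological_basisE vimageI)
    qed
    have "\<not> open {..g c}"
    proof
      assume "open {..g c}"
      then obtain b where b: "b \<in> B" "c \<in> b" "g ` b \<subseteq> {..g c}"
        using * by force
      then have "M b = g c"
        unfolding M_def by (intro Greatest_equality) auto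
      then show False
        using c b(1) by force
    qed
    then obtain b where b: "b \<in> B" "c \<in> b" "g ` b \<subseteq> {g c..}"
      using * double_arrow_clopen_ray[of "g c"] by (metis atLeast_iff order_refl)
    then have "m b = g c"
      unfolding m_def by (intro Least_equality) auto
    then show "g c \<in> m ` B"
      using b(1) by force
  qed
  then show ?thesis
    using B(1) by (meson countable_Un countable_image countable_subset)
qed

section \<open>A countable dense set meeting each fibre at most once\<close>

text \<open>A neighbourhood of (x, 0) reaches to the left and one of (x, 1) to the right, so either
  contains all lower points over some real interval. Density in the first factor thus reduces to
  density in the reals.\<close>

lemma open_double_arrow_contains_interval:
  fixes U :: "double_arrow set"
  assumes "open U" "U \<noteq> {}"
  obtains y x where "0 \<le> y" "y < x" "x \<le> 1" "\<And>q. y < q \<Longrightarrow> q < x \<Longrightarrow> Abs_double_arrow (q, 0) \<in> U"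
proof -
  obtain a where a: "a \<in> U"
    using assms(2) by blast
  show thesis
  proof (cases a rule: Rep_double_arrow_cases)
    case (1 x)
    then have "Abs_double_arrow (0, 1) < a"
      using Rep_double_arrow_Abs_1[of 0] by (simp add: less_double_arrow.rep_eq)
    then obtain b where b: "b < a" "{b<..a} \<subseteq> U"
      using open_left[OF assms(1) a] by blast
    define y where "y = fst (Rep_double_arrow b)"
    \<comment> \<open>Strictness holds because no point over \<open>x\<close> lies below (x,
      0).\<close>
    have y: "0 \<le> y" "y < x"
      using b(1) 1 by (cases b rule: Rep_double_arrow_cases; simp add: y_def less_double_arrow.rep_eq)+
    show thesis
    proof (rule that[OF y(1,2) 1(3)])
      fix q assume q: "y < q" "q < x"
      then have "Rep_double_arrow (Abs_double_arrow (q, 0)) = (q, 0)"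
        using y 1 by (intro Rep_double_arrow_Abs_0) auto
      then have "Abs_double_arrow (q, 0) \<in> {b<..a}"
        using q 1 by (auto simp: y_def less_eq_double_arrow_def less_double_arrow.rep_eq split: prod.splits)
      then show "Abs_double_arrow (q, 0) \<in> U"
        using b(2) by blast
    qed
  next
    case (2 x)
    then have "a < Abs_double_arrow (1, 0)"
      using Rep_double_arrow_Abs_0[of 1] by (simp add: less_double_arrow.rep_eq)
    then obtain b where b: "a < b" "{a..<b} \<subseteq> U"
      using open_right[OF assms(1) a] by blast
    define y where "y = fst (Rep_double_arrow b)"
    have y: "x < y" "y \<le> 1"
      using b(1) 2 by (cases b rule: Rep_double_arrow_cases; simp add: y_def less_double_arrow.rep_eq)+
    show thesis
    proof (rule that[OF 2(2) y])
      fix q assume q: "x < q" "q < y"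
      then have "Rep_double_arrow (Abs_double_arrow (q, 0)) = (q, 0)"
        using y 2 by (intro Rep_double_arrow_Abs_0) auto
      then have "Abs_double_arrow (q, 0) \<in> {a..<b}"
        using q 2 by (auto simp: y_def less_eq_double_arrow_def less_double_arrow.rep_eq split: prod.splits)
      then show "Abs_double_arrow (q, 0) \<in> U"
        using b(2) by blast
    qed
  qed
qed

text \<open>The fibres over the coset \<open>n\<alpha> + \<rat>\<close>, for \<open>\<alpha>\<close> irrational, carry the \<open>n\<close>-th point of a countable
  dense subset of the second factor: the cosets are dense and pairwise disjoint.\<close>

lemma countable_dense_inj_on_fst:
  obtains D :: "(double_arrow \<times> 'a::second_countable_topology) set"
  where "countable D" "closure D = UNIV" "inj_on fst D"
proof -
  obtain C :: "'a set" where C: "countable C" "\<And>U. open U \<Longrightarrow> U \<noteq> {} \<Longrightarrow> \<exists>d\<in>C. d \<in> U"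
    using countable_dense_setE by blast
  have "C \<noteq> {}"
    using C(2)[of UNIV] by auto
  have "(\<rat> :: real set) \<noteq> UNIV"
    using countable_rat uncountable_UNIV_real by metis
  then obtain \<alpha> :: real where \<alpha>: "\<alpha> \<notin> \<rat>"
    by blast
  define f where "f = (\<lambda>(n::nat, r). (Abs_double_arrow (real n * \<alpha> + r, 0), from_nat_into C n))"
  \<comment> \<open>The bounds keep the real coordinate in (0, 1], where
    \<open>Abs_double_arrow\<close> is inverted by \<open>Rep_double_arrow\<close>.\<close>
  define I where "I = {(n, r). r \<in> \<rat> \<and> 0 < real n * \<alpha> + r \<and> real n * \<alpha> + r \<le> 1}"
  have "countable I"
    by (rule countable_subset[of _ "UNIV \<times> \<rat>"]) (auto simp: I_def intro: countable_rat)
  then have "countable (f ` I)"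
    by simp
  moreover have "inj_on fst (f ` I)"
  proof (rule inj_onI)
    fix u v assume "u \<in> f ` I" "v \<in> f ` I" and eq: "fst u = fst v"
    then obtain n r k s where u: "u = f (n, r)" "(n, r) \<in> I" and v: "v = f (k, s)" "(k, s) \<in> I"
      by auto
    have "real n * \<alpha> + r = real k * \<alpha> + s"
      using arg_cong[OF eq, of "\<lambda>a. fst (Rep_double_arrow a)"] u v
      by (simp add: f_def I_def Rep_double_arrow_Abs_0)
    then have "(real n - real k) * \<alpha> = s - r"
      by (simp add: algebra_simps)
    moreover have "s - r \<in> \<rat>"
      using u v by (auto simp: I_def)
    ultimately have "(real n - real k) * \<alpha> \<in> \<rat>"
      by simp
    \<comment> \<open>For \<open>n = k\<close> the quotient is 0 by the convention on division by
      zero, hence still rational; otherwise it equals \<alpha>.\<close>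
    then have "(real n - real k) * \<alpha> / (real n - real k) \<in> \<rat>"
      by (intro Rats_divide Rats_diff Rats_of_nat)
    then have "n = k"
      using \<alpha> by (cases "n = k") auto
    then show "u = v"
      using \<open>real n * \<alpha> + r = real k * \<alpha> + s\<close> u v by simp
  qed
  moreover have "closure (f ` I) = UNIV"
  proof -
    have "f ` I \<inter> W \<noteq> {}" if W: "open W" "W \<noteq> {}" for W
    proof -
      obtain U V where UV: "open U" "open V" "U \<noteq> {}" "V \<noteq> {}" "U \<times> V \<subseteq> W"
      proof -
        obtain w where "w \<in> W"
          using W(2) by blast
        with W(1) obtain U V where "open U" "open V" "w \<in> U \<times> V" "U \<times> V \<subseteq> W"
          by (rule open_prod_elim)
        then show thesis
          using that[of U V] by auto
      qed
      obtain c where "c \<in> C" "c \<in> V"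
        using C(2) UV by blast
      then obtain n where n: "from_nat_into C n \<in> V"
        using C(1) by (metis from_nat_into_surj)
      obtain y x where yx: "0 \<le> y" "y < x" "x \<le> 1" "\<And>q. y < q \<Longrightarrow> q < x \<Longrightarrow> Abs_double_arrow (q, 0) \<in> U"
        using open_double_arrow_contains_interval UV by metis
      \<comment> \<open>Translating the interval by \<open>- real n * \<alpha>\<close> turns density
        of the coset into density of the rationals.\<close>
      obtain r where r: "r \<in> \<rat>" "y - real n * \<alpha> < r" "r < x - real n * \<alpha>"
        using Rats_dense_in_real[of "y - real n * \<alpha>" "x - real n * \<alpha>"] yx by auto
      have "(n, r) \<in> I"
        using r yx by (auto simp: I_def)
      moreover have "f (n, r) \<in> U \<times> V"
        using r yx n by (auto simp: f_def)
      ultimately have "f (n, r) \<in> f ` I \<inter> W"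
        using UV(5) by (metis IntI imageI subsetD)
      then show ?thesis
        by (metis emptyE)
    qed
    then show ?thesis
      using dense_intersects_open[of euclidean "f ` I"] by simp
  qed
  ultimately show thesis
    using that by blast
qed

section \<open>The Cantor set and its maps into the double arrow space\<close>

text \<open>A basic open set restricts only finitely many coordinates, so flipping an unrestricted
  one gives a second point in it.\<close>

lemma cantor_not_open_singleton: "\<not> open {c}" for c :: "nat \<Rightarrow> bool"
proof
  assume "open {c}"
  then have "openin cantor_space {c}"
    by (simp add: cantor_space_eq_euclidean)
  then obtain U where U: "finite {i. U i \<noteq> (UNIV :: bool set)}" "c \<in> Pi\<^sub>E UNIV U" "Pi\<^sub>E UNIV U \<subseteq> {c}"
    by (auto simp: openin_product_topology_alt)
  obtain n where n: "U n = UNIV"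
    using U(1) infinite_UNIV_nat ex_new_if_finite by blast
  then have "c(n := \<not> c n) \<in> Pi\<^sub>E UNIV U"
    using U(2) by (auto simp: PiE_iff)
  then have "c(n := \<not> c n) = c"
    using U(3) by blast
  then show False
    by (metis fun_upd_same)
qed

text \<open>The map has countably many values, so its closed level sets form a countable cover; by
  Baire one of them has nonempty interior.\<close>

lemma continuous_cantor_double_arrow_locally_constant_somewhere:
  fixes g :: "(nat \<Rightarrow> bool) \<Rightarrow> double_arrow"
  assumes g: "continuous_on UNIV g"
  obtains U k where "open U" "U \<noteq> {}" "\<And>c. c \<in> U \<Longrightarrow> g c = k"
proof -
  let ?G = "(\<lambda>k. g -` {k}) ` range g"
  have "compact_space cantor_space" "Hausdorff_space cantor_space"
    by (simp_all add: compact_space_product_topology Hausdorff_space_product_topology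
        compact_space_discrete_topology)
  then have X: "locally_compact_space cantor_space" "regular_space cantor_space"
    by (simp_all add: compact_imp_locally_compact_space compact_Hausdorff_imp_regular_space)
  have "\<exists>T\<in>?G. cantor_space interior_of T \<noteq> {}"
  proof (rule ccontr)
    assume no: "\<not> ?thesis"
    have "cantor_space interior_of \<Union>?G = {}"
    proof (rule Baire_category_alt)
      show "completely_metrizable_space cantor_space \<or> locally_compact_space cantor_space \<and> regular_space cantor_space"
        using X by blast
      show "countable ?G"
        using countable_range_into_double_arrow[OF g] by simp
      fix T assume "T \<in> ?G"
      then show "closedin cantor_space T \<and> cantor_space interior_of T = {}"
        using no g by (auto simp: cantor_space_eq_euclidean intro: closed_vimage)
    qed
    moreover have "\<Union>?G = UNIV"
      by auto
    ultimately show False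
      by (simp add: cantor_space_eq_euclidean)
  qed
  then obtain k where k: "cantor_space interior_of (g -` {k}) \<noteq> {}"
    by blast
  have "open (cantor_space interior_of (g -` {k}))"
    by (metis cantor_space_eq_euclidean open_openin openin_interior_of)
  then show thesis
    using that[OF _ k] interior_of_subset[of cantor_space "g -` {k}"] by blast
qed

theorem corollary2p4:
  shows "\<not> countable_dense_homogeneous (prod_topology double_arrow_space cantor_space)"
proof
  assume cdh: "countable_dense_homogeneous (prod_topology double_arrow_space cantor_space)"
  let ?X = "euclidean :: (double_arrow \<times> (nat \<Rightarrow> bool)) topology"
  have X: "prod_topology double_arrow_space cantor_space = ?X"
    by (simp add: cantor_space_eq_euclidean)
  obtain D :: "(double_arrow \<times> (nat \<Rightarrow> bool)) set"
    where D: "countable D" "closure D = UNIV" "inj_on fst D"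
    using countable_dense_inj_on_fst .
  obtain A where A: "countable A" "closure A = (UNIV :: double_arrow set)"
    using separable_double_arrow_space by (auto simp: separable_space_def)
  obtain Q :: "(nat \<Rightarrow> bool) set" where Q: "countable Q" "\<And>U. open U \<Longrightarrow> U \<noteq> {} \<Longrightarrow> \<exists>d\<in>Q. d \<in> U"
    using countable_dense_setE by blast
  have "closure Q = UNIV"
    using dense_intersects_open[of euclidean Q] Q(2) by auto
  then have "closure (A \<times> Q) = UNIV"
    using A by (simp add: closure_Times)
  then obtain h where h: "homeomorphic_map ?X ?X h" "h ` (A \<times> Q) = D"
    using cdh[unfolded X countable_dense_homogeneous_def] A Q D by (metis (no_types, lifting) euclidean_closure_of
        countable_SIGMA subset_UNIV topspace_euclidean)
  have "continuous_on UNIV h"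
    using homeomorphic_imp_continuous_map[OF h(1)] by simp
  have "inj h"
    using homeomorphic_imp_injective_map[OF h(1)] by simp
  \<comment> \<open>Any point of \<open>A\<close> will do: \<open>h\<close> sends all of
    \<open>{a} \<times> Q\<close> into \<open>D\<close>.\<close>
  obtain a where a: "a \<in> A"
    using A(2) by fastforce
  have "continuous_on UNIV (\<lambda>c. fst (h (a, c)))"
    by (intro continuous_intros continuous_on_compose2[OF \<open>continuous_on UNIV h\<close>]) auto
  then obtain U k where U: "open U" "U \<noteq> {}" "\<And>c. c \<in> U \<Longrightarrow> fst (h (a, c)) = k"
    using continuous_cantor_double_arrow_locally_constant_somewhere by metis
  obtain c where c: "c \<in> Q" "c \<in> U"
    using Q(2) U by blast
  \<comment> \<open>Removing \<open>c\<close> leaves a nonempty open set, in which density of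
    \<open>Q\<close> yields a second point \<open>d\<close>. Then \<open>h (a, c)\<close> and
    \<open>h (a, d)\<close> are points of \<open>D\<close> with the same first coordinate
    \<open>k\<close>.\<close>
  have "U - {c} \<noteq> {}"
    using U c cantor_not_open_singleton[of c] by (metis Diff_eq_empty_iff empty_iff subset_singletonD)
  moreover have "closed {c}"
    using closedin_Hausdorff_singleton[of cantor_space c]
    by (simp add: Hausdorff_space_product_topology cantor_space_eq_euclidean[symmetric] closed_closedin)
  ultimately obtain d where d: "d \<in> Q" "d \<in> U" "d \<noteq> c"
    using Q(2)[of "U - {c}"] U(1) by (auto simp: open_Diff)
  have "h (a, c) \<in> D" "h (a, d) \<in> D"
    using h(2) a c d by auto
  then have "h (a, c) = h (a, d)"
    using D(3) U(3) c d by (metis inj_onD)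
  then show False
    using \<open>inj h\<close> d by (auto dest: injD)
qed

end
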